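(* Let $X\neq\{0\}$ be a Banach space, let $C$ be a subcone of $\mathcal{N}(X)$, and let $D\subseteq\mathbb{R}^X_+$ be a cone with vertex (i.e. $0\in D$) such that $C\subseteq D$. Then the following statements are equivalent: 1) $C$ is contained in a single part of $D$, and the Hilbert projective metric induced by $D$ on $[C]$ coincides with the symmetric logarithmic metric; that is, $d_D([p],[q])=\log\frac{M_{\log}(q/p)}{m_{\log}(q/p)}$ for every $p,q\in C$. 2) For every $p,q\in C$, one has $\beta p-q\in D$ whenever $\beta>M_{\log}(q/p)$, and $q-\alpha p\in D$ whenever $0<\alpha<m_{\log}(q/p)$. 3) For every $p,q\in C$ and $0<\theta<1$ such that $q(x)\le\theta p(x)$ for every $x\in X$, we have $p-q\in D$. 4) $D$ contains every uniformly positive difference of elements of $C$; that is, $$\{f\in C-C\mid \text{there exist } r\in C \text{ and } \varepsilon>0 \text{ such that } f(x)\ge\varepsilon r(x) \text{ for every } x\in X\}\subset D.$$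
   Context: $\mathcal{N}(X)$ is the set of all norms on $X$ equivalent to the given norm of the Banach space $X$. $\mathbb{R}^X_+$ is the cone of all functions $f:X\to\mathbb{R}$ with $f\ge0$ pointwise. A cone in a real vector space $V$ is a nonempty convex set $C\subset V$ with $\lambda C\subset C$ for all $\lambda>0$ and $C\cap(-C)\subset\{0\}$; it is a cone with vertex if $0\in C$. A subcone is a subset that is itself a cone. $C-C=\{p-q\mid p,q\in C\}$. The induced relation is $u\preceq_D v$ iff $v-u\in D$. Nonzero $u,v\in D$ are comparable if $\alpha u\preceq_D v\preceq_D\beta u$ for some $\alpha,\beta>0$; this is an equivalence relation on $D\setminus\{0\}$ whose classes are the parts of $D$. $[C]$ denotes the set of classes $[p]$, $p\in C$, modulo multiplication by positive scalars. For comparable $u,v\in D\setminus\{0\}$, $m_D(v/u)=\sup\{\alpha>0\mid\alpha u\preceq_D v\}$, $M_D(v/u)=\inf\{\beta>0\mid v\preceq_D\beta u\}$ and $d_D([u],[v])=\log\frac{M_D(v/u)}{m_D(v/u)}$ (Hilbert projective metric). For $p,q\in\mathcal{N}(X)$, $M_{\log}(q/p)=\sup_{x\ne0}\frac{q(x)}{p(x)}$ and $m_{\log}(q/p)=\inf_{x\neq0}\frac{q(x)}{p(x)}$; the symmetric logarithmic metric is $d_{\log}([p],[q])=\log\frac{M_{\log}(q/p)}{m_{\log}(q/p)}$. *)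

theory Defs
  imports "HOL-Analysis.Analysis" "HOL-Library.Function_Algebras"
begin

instantiation "fun" :: (type, real_vector) real_vector
begin

definition scaleR_fun :: "real \<Rightarrow> ('a \<Rightarrow> 'b) \<Rightarrow> 'a \<Rightarrow> 'b"
  where "scaleR_fun c f = (\<lambda>x. c *\<^sub>R f x)"

instance
  by standard (auto simp: scaleR_fun_def plus_fun_def algebra_simps)

end

lemma scaleR_fun_apply [simp]: "(c *\<^sub>R f) x = c *\<^sub>R f x"
  by (simp add: scaleR_fun_def)

text \<open>Unlike the library predicate \<^const>\<open>cone\<close>, only strictly positive scalars are used (so
  that \<open>0\<close> need not belong to the cone), and convexity and salience are required. Note that
  \<open>- C\<close> on sets denotes the complement, hence the image under \<^const>\<open>uminus\<close>.\<close>

definition is_cone :: "'v::real_vector set \<Rightarrow> bool"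
  where "is_cone C \<longleftrightarrow> C \<noteq> {} \<and> convex C \<and> (\<forall>c>0. \<forall>u\<in>C. c *\<^sub>R u \<in> C)
    \<and> C \<inter> uminus ` C \<subseteq> {0}"

definition cone_with_vertex :: "'v::real_vector set \<Rightarrow> bool"
  where "cone_with_vertex C \<longleftrightarrow> is_cone C \<and> 0 \<in> C"

definition subcone :: "'v::real_vector set \<Rightarrow> 'v set \<Rightarrow> bool"
  where "subcone C K \<longleftrightarrow> C \<subseteq> K \<and> is_cone C"

definition cone_differences :: "'v::real_vector set \<Rightarrow> 'v set"
  where "cone_differences C = {p - q | p q. p \<in> C \<and> q \<in> C}"

definition cone_le :: "'v::real_vector set \<Rightarrow> 'v \<Rightarrow> 'v \<Rightarrow> bool"
  where "cone_le D u v \<longleftrightarrow> v - u \<in> D"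

definition comparable :: "'v::real_vector set \<Rightarrow> 'v \<Rightarrow> 'v \<Rightarrow> bool"
  where "comparable D u v \<longleftrightarrow>
    (\<exists>\<alpha>>0. \<exists>\<beta>>0. cone_le D (\<alpha> *\<^sub>R u) v \<and> cone_le D v (\<beta> *\<^sub>R u))"

definition parts :: "'v::real_vector set \<Rightarrow> 'v set set"
  where "parts D = (D - {0}) // {(u, v). u \<in> D - {0} \<and> v \<in> D - {0} \<and> comparable D u v}"

text \<open>The class of \<open>u\<close> modulo multiplication by positive scalars.\<close>

definition ray :: "'v::real_vector \<Rightarrow> 'v set"
  where "ray u = {c *\<^sub>R u | c. c > 0}"

definition m_cone :: "'v::real_vector set \<Rightarrow> 'v \<Rightarrow> 'v \<Rightarrow> real"
  where "m_cone D v u = Sup {\<alpha>. \<alpha> > 0 \<and> cone_le D (\<alpha> *\<^sub>R u) v}"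

definition M_cone :: "'v::real_vector set \<Rightarrow> 'v \<Rightarrow> 'v \<Rightarrow> real"
  where "M_cone D v u = Inf {\<beta>. \<beta> > 0 \<and> cone_le D v (\<beta> *\<^sub>R u)}"

text \<open>The distance of two classes is computed from arbitrary representatives; independence of
  the choice is shown in \<open>hilbert_dist_ray\<close> below.\<close>

definition hilbert_dist :: "'v::real_vector set \<Rightarrow> 'v set \<Rightarrow> 'v set \<Rightarrow> real"
  where "hilbert_dist D U V =
    (THE d. \<exists>u\<in>U. \<exists>v\<in>V. d = ln (M_cone D v u / m_cone D v u))"

definition nonneg_functions :: "('a \<Rightarrow> real) set"
  where "nonneg_functions = {f. \<forall>x. f x \<ge> 0}"

definition is_norm :: "('a::real_vector \<Rightarrow> real) \<Rightarrow> bool"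
  where "is_norm p \<longleftrightarrow> (\<forall>x. p x \<ge> 0) \<and> (\<forall>x. p x = 0 \<longleftrightarrow> x = 0)
    \<and> (\<forall>c x. p (c *\<^sub>R x) = \<bar>c\<bar> * p x) \<and> (\<forall>x y. p (x + y) \<le> p x + p y)"

definition equivalent_norms :: "('a::real_normed_vector \<Rightarrow> real) set"
  where "equivalent_norms = {p. is_norm p \<and>
    (\<exists>a>0. \<exists>b>0. \<forall>x. a * norm x \<le> p x \<and> p x \<le> b * norm x)}"

definition M_log :: "('a::real_normed_vector \<Rightarrow> real) \<Rightarrow> ('a \<Rightarrow> real) \<Rightarrow> real"
  where "M_log q p = (SUP x\<in>{x. x \<noteq> 0}. q x / p x)"

definition m_log :: "('a::real_normed_vector \<Rightarrow> real) \<Rightarrow> ('a \<Rightarrow> real) \<Rightarrow> real"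
  where "m_log q p = (INF x\<in>{x. x \<noteq> 0}. q x / p x)"

text \<open>Again defined on classes; see \<open>log_dist_ray\<close> for independence of representatives.\<close>

definition log_dist :: "('a::real_normed_vector \<Rightarrow> real) set \<Rightarrow> ('a \<Rightarrow> real) set \<Rightarrow> real"
  where "log_dist P Q = (THE d. \<exists>p\<in>P. \<exists>q\<in>Q. d = ln (M_log q p / m_log q p))"

lemma is_cone_scaleR_iff:
  assumes "is_cone D" "c > 0"
  shows "c *\<^sub>R u \<in> D \<longleftrightarrow> u \<in> D"
proof
  assume "c *\<^sub>R u \<in> D"
  then have "inverse c *\<^sub>R (c *\<^sub>R u) \<in> D"
    using assms unfolding is_cone_def by (meson positive_imp_inverse_positive)
  then show "u \<in> D" using assms by simp
qed (use assms in \<open>auto simp: is_cone_def\<close>)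

lemma cone_le_scaleR:
  assumes "is_cone D" "a > 0"
  shows "cone_le D (a *\<^sub>R u) (a *\<^sub>R v) \<longleftrightarrow> cone_le D u v"
  using is_cone_scaleR_iff[OF assms, of "v - u"] by (simp add: cone_le_def scaleR_diff_right)

lemma cone_le_scaleR_left:
  assumes "is_cone D" "a > 0" "b > 0"
  shows "cone_le D (t *\<^sub>R (a *\<^sub>R u)) (b *\<^sub>R v) \<longleftrightarrow> cone_le D ((t * a / b) *\<^sub>R u) v"
  using cone_le_scaleR[OF assms(1,3), of "(t * a / b) *\<^sub>R u" v] assms by simp

lemma cone_le_scaleR_right:
  assumes "is_cone D" "a > 0" "b > 0"
  shows "cone_le D (b *\<^sub>R v) (t *\<^sub>R (a *\<^sub>R u)) \<longleftrightarrow> cone_le D v ((t * a / b) *\<^sub>R u)"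
  using cone_le_scaleR[OF assms(1,3), of v "(t * a / b) *\<^sub>R u"] assms by simp

lemma Sup_scale:
  fixes A :: "real set"
  assumes "A \<noteq> {}" "bdd_above A" "c > 0"
  shows "Sup ((\<lambda>x. c * x) ` A) = c * Sup A"
  using continuous_at_Sup_mono[of "\<lambda>x. c * x" A] assms
  by (simp add: mono_def continuous_intros)

lemma Inf_scale:
  fixes A :: "real set"
  assumes "A \<noteq> {}" "bdd_below A" "c > 0"
  shows "Inf ((\<lambda>x. c * x) ` A) = c * Inf A"
  using continuous_at_Inf_mono[of "\<lambda>x. c * x" A] assms
  by (simp add: mono_def continuous_intros)

lemma comparable_bdd_above:
  assumes D: "is_cone D" "u \<noteq> 0" "u \<in> D" "comparable D u v"
  shows "bdd_above {\<alpha>. \<alpha> > 0 \<and> cone_le D (\<alpha> *\<^sub>R u) v}"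
proof -
  obtain b where b: "b > 0" "b *\<^sub>R u - v \<in> D"
    using D by (auto simp: comparable_def cone_le_def)
  have "a \<le> b" if a: "v - a *\<^sub>R u \<in> D" for a
  proof (rule ccontr)
    assume "\<not> a \<le> b"
    have "(1/2) *\<^sub>R (b *\<^sub>R u - v) + (1/2) *\<^sub>R (v - a *\<^sub>R u) \<in> D"
      using D(1) a b unfolding is_cone_def by (intro convexD) auto
    also have "(1/2) *\<^sub>R (b *\<^sub>R u - v) + (1/2) *\<^sub>R (v - a *\<^sub>R u) = ((a - b) / 2) *\<^sub>R (- u)"
      by (simp add: algebra_simps diff_divide_distrib)
    finally have "- u \<in> D"
      using is_cone_scaleR_iff[OF D(1), of "(a - b) / 2" "- u"] \<open>\<not> a \<le> b\<close> by simp
    then have "u \<in> D \<inter> uminus ` D" using D by (metis IntI imageI minus_minus)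
    then show False using D unfolding is_cone_def by blast
  qed
  then show ?thesis by (auto simp: cone_le_def intro!: bdd_aboveI)
qed

lemma m_cone_scaleR:
  assumes "is_cone D" "u \<noteq> 0" "u \<in> D" "comparable D u v" "a > 0" "b > 0"
  shows "m_cone D (b *\<^sub>R v) (a *\<^sub>R u) = (b / a) * m_cone D v u"
proof -
  let ?A = "{\<alpha>. \<alpha> > 0 \<and> cone_le D (\<alpha> *\<^sub>R u) v}"
  have "t \<in> (\<lambda>x. (b / a) * x) ` ?A \<longleftrightarrow> t > 0 \<and> cone_le D (t *\<^sub>R (a *\<^sub>R u)) (b *\<^sub>R v)" for t
    unfolding cone_le_scaleR_left[OF assms(1,5,6)]
    using assms(5,6) by (auto simp: image_iff intro!: exI[of _ "t * a / b"])
  then have eq: "{t. t > 0 \<and> cone_le D (t *\<^sub>R (a *\<^sub>R u)) (b *\<^sub>R v)} = (\<lambda>x. (b / a) * x) ` ?A"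
    by blast
  have "?A \<noteq> {}" using assms(4) by (auto simp: comparable_def)
  then show ?thesis unfolding m_cone_def eq
    by (rule Sup_scale) (use comparable_bdd_above assms in auto)
qed

lemma M_cone_scaleR:
  assumes "is_cone D" "comparable D u v" "a > 0" "b > 0"
  shows "M_cone D (b *\<^sub>R v) (a *\<^sub>R u) = (b / a) * M_cone D v u"
proof -
  let ?A = "{\<beta>. \<beta> > 0 \<and> cone_le D v (\<beta> *\<^sub>R u)}"
  have "t \<in> (\<lambda>x. (b / a) * x) ` ?A \<longleftrightarrow> t > 0 \<and> cone_le D (b *\<^sub>R v) (t *\<^sub>R (a *\<^sub>R u))" for t
    unfolding cone_le_scaleR_right[OF assms(1,3,4)]
    using assms(3,4) by (auto simp: image_iff intro!: exI[of _ "t * a / b"])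
  then have eq: "{t. t > 0 \<and> cone_le D (b *\<^sub>R v) (t *\<^sub>R (a *\<^sub>R u))} = (\<lambda>x. (b / a) * x) ` ?A"
    by blast
  have "?A \<noteq> {}" using assms(2) by (auto simp: comparable_def)
  then show ?thesis unfolding M_cone_def eq
    by (rule Inf_scale) (use assms in \<open>auto intro!: bdd_belowI[of _ 0]\<close>)
qed

lemma hilbert_dist_ray:
  assumes "is_cone D" "u \<in> D - {0}" "comparable D u v"
  shows "hilbert_dist D (ray u) (ray v) = ln (M_cone D v u / m_cone D v u)"
proof -
  have *: "M_cone D (b *\<^sub>R v) (a *\<^sub>R u) / m_cone D (b *\<^sub>R v) (a *\<^sub>R u)
      = M_cone D v u / m_cone D v u" if "a > 0" "b > 0" for a b
    using assms that by (simp add: M_cone_scaleR m_cone_scaleR)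
  show ?thesis unfolding hilbert_dist_def
  proof (rule the_equality)
    show "\<exists>u'\<in>ray u. \<exists>v'\<in>ray v. ln (M_cone D v u / m_cone D v u)
        = ln (M_cone D v' u' / m_cone D v' u')"
      by (rule bexI[of _ u], rule bexI[of _ v]) (auto simp: ray_def intro!: exI[of _ 1])
  qed (auto simp: ray_def *)
qed

lemma equivalent_norms_ratio_bdd:
  assumes "p \<in> equivalent_norms" "q \<in> equivalent_norms"
  shows "bdd_above ((\<lambda>x. q x / p x) ` S)" "bdd_below ((\<lambda>x. q x / p x) ` S)"
proof -
  obtain a where a: "a > 0" "\<And>x. a * norm x \<le> p x"
    using assms(1) unfolding equivalent_norms_def by blast
  obtain b where b: "b > 0" "\<And>x. q x \<le> b * norm x"
    using assms(2) unfolding equivalent_norms_def by blast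
  have nn: "p x \<ge> 0" "q x \<ge> 0" for x
    using assms by (auto simp: equivalent_norms_def is_norm_def)
  have "q x / p x \<le> b / a" for x
  proof (cases "p x = 0")
    case False
    have "q x \<le> (b / a) * (a * norm x)" using a b by simp
    also have "\<dots> \<le> (b / a) * p x" using a b by (intro mult_left_mono) auto
    finally show ?thesis using False nn(1)[of x] by (simp add: divide_le_eq)
  qed (use a b in simp)
  then show "bdd_above ((\<lambda>x. q x / p x) ` S)" by (auto intro!: bdd_aboveI)
  show "bdd_below ((\<lambda>x. q x / p x) ` S)"
    using nn by (auto intro!: bdd_belowI[of _ 0])
qed

lemma M_m_log_scaleR:
  fixes p q :: "'a::real_normed_vector \<Rightarrow> real"
  assumes "\<exists>x::'a. x \<noteq> 0" "p \<in> equivalent_norms" "q \<in> equivalent_norms" "a > 0" "b > 0"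
  shows "M_log (b *\<^sub>R q) (a *\<^sub>R p) = (b / a) * M_log q p"
    and "m_log (b *\<^sub>R q) (a *\<^sub>R p) = (b / a) * m_log q p"
proof -
  have eq: "(\<lambda>x. (b *\<^sub>R q) x / (a *\<^sub>R p) x) ` {x. x \<noteq> 0}
      = (\<lambda>t. (b / a) * t) ` (\<lambda>x. q x / p x) ` {x. x \<noteq> 0}"
    by (simp add: image_image mult.commute)
  show "M_log (b *\<^sub>R q) (a *\<^sub>R p) = (b / a) * M_log q p"
    unfolding M_log_def eq
    by (rule Sup_scale) (use assms equivalent_norms_ratio_bdd in auto)
  show "m_log (b *\<^sub>R q) (a *\<^sub>R p) = (b / a) * m_log q p"
    unfolding m_log_def eq
    by (rule Inf_scale) (use assms equivalent_norms_ratio_bdd in auto)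
qed

lemma log_dist_ray:
  fixes p q :: "'a::real_normed_vector \<Rightarrow> real"
  assumes "\<exists>x::'a. x \<noteq> 0" "p \<in> equivalent_norms" "q \<in> equivalent_norms"
  shows "log_dist (ray p) (ray q) = ln (M_log q p / m_log q p)"
proof -
  have *: "M_log (b *\<^sub>R q) (a *\<^sub>R p) / m_log (b *\<^sub>R q) (a *\<^sub>R p) = M_log q p / m_log q p"
    if "a > 0" "b > 0" for a b
    using M_m_log_scaleR[OF assms that] that by simp
  show ?thesis unfolding log_dist_def
  proof (rule the_equality)
    show "\<exists>p'\<in>ray p. \<exists>q'\<in>ray q. ln (M_log q p / m_log q p) = ln (M_log q' p' / m_log q' p')"
      by (rule bexI[of _ p], rule bexI[of _ q]) (auto simp: ray_def intro!: exI[of _ 1])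
  qed (auto simp: ray_def *)
qed

end

theory Submission
  imports Defs
begin

text \<open>Since \<open>D\<close> consists of nonnegative functions, \<open>\<beta> p - q \<in> D\<close> forces
  \<open>\<beta> \<ge> M\<^sub>l\<^sub>o\<^sub>g(q/p)\<close> and \<open>q - \<alpha> p \<in> D\<close> forces \<open>\<alpha> \<le> m\<^sub>l\<^sub>o\<^sub>g(q/p)\<close>. Hence
  \<open>m\<^sub>D \<le> m\<^sub>l\<^sub>o\<^sub>g\<close> and \<open>M\<^sub>l\<^sub>o\<^sub>g \<le> M\<^sub>D\<close> always hold, and the two metrics agree exactly when both
  inequalities are equalities, which is 2). The remaining equivalences come from rescaling
  inside \<open>C\<close> and from the fact that any two norms in \<open>C\<close> bound each other up to constants.\<close>

section \<open>Order, comparability and parts of a cone\<close>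

lemma is_cone_add:
  assumes "is_cone D" "u \<in> D" "v \<in> D"
  shows "u + v \<in> D"
proof -
  have "(1/2) *\<^sub>R u + (1/2) *\<^sub>R v \<in> D"
    using assms unfolding is_cone_def by (intro convexD) auto
  then have "(1/2) *\<^sub>R (u + v) \<in> D" by (simp add: scaleR_add_right)
  then show ?thesis using is_cone_scaleR_iff[OF assms(1), of "1/2"] by simp
qed

lemma cone_le_trans:
  assumes "is_cone D" "cone_le D u v" "cone_le D v w"
  shows "cone_le D u w"
  using is_cone_add[OF assms(1), of "w - v" "v - u"] assms(2,3) by (simp add: cone_le_def)

lemma comparable_sym:
  assumes "is_cone D" "comparable D u v"
  shows "comparable D v u"
proof -
  obtain a b where ab: "a > 0" "b > 0" "cone_le D (a *\<^sub>R u) v" "cone_le D v (b *\<^sub>R u)"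
    using assms(2) by (auto simp: comparable_def)
  have "cone_le D (inverse b *\<^sub>R v) u" "cone_le D u (inverse a *\<^sub>R v)"
    using cone_le_scaleR[OF assms(1), of "inverse b" v "b *\<^sub>R u"]
      cone_le_scaleR[OF assms(1), of "inverse a" "a *\<^sub>R u" v] ab by auto
  then show ?thesis unfolding comparable_def
    using ab(1,2) positive_imp_inverse_positive by blast
qed

lemma comparable_trans:
  assumes "is_cone D" "comparable D u v" "comparable D v w"
  shows "comparable D u w"
proof -
  obtain a b where ab: "a > 0" "b > 0" "cone_le D (a *\<^sub>R u) v" "cone_le D v (b *\<^sub>R u)"
    using assms(2) by (auto simp: comparable_def)
  obtain c d where cd: "c > 0" "d > 0" "cone_le D (c *\<^sub>R v) w" "cone_le D w (d *\<^sub>R v)"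
    using assms(3) by (auto simp: comparable_def)
  have "cone_le D ((c * a) *\<^sub>R u) (c *\<^sub>R v)" "cone_le D (d *\<^sub>R v) ((d * b) *\<^sub>R u)"
    using cone_le_scaleR[OF assms(1) cd(1), of "a *\<^sub>R u" v]
      cone_le_scaleR[OF assms(1) cd(2), of v "b *\<^sub>R u"] ab by auto
  then have "cone_le D ((c * a) *\<^sub>R u) w" "cone_le D w ((d * b) *\<^sub>R u)"
    using cone_le_trans[OF assms(1)] cd by blast+
  then show ?thesis unfolding comparable_def
    using ab(1,2) cd(1,2) mult_pos_pos by blast
qed

text \<open>Turns the quotient formulation of condition 1) into a pairwise one. A part is the class
  of some \<open>w\<close>, so any two of its elements are comparable through \<open>w\<close>;
  conversely the class of any one element of \<open>C\<close> already contains all of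
  \<open>C\<close>.\<close>

lemma contained_in_part_iff:
  assumes "is_cone D" "C \<subseteq> D - {0}" "C \<noteq> {}"
  shows "(\<exists>P\<in>parts D. C \<subseteq> P) \<longleftrightarrow> (\<forall>u\<in>C. \<forall>v\<in>C. comparable D u v)"
proof
  assume "\<exists>P\<in>parts D. C \<subseteq> P"
  then obtain w where "\<And>u. u \<in> C \<Longrightarrow> comparable D w u"
    unfolding parts_def quotient_def by blast
  then show "\<forall>u\<in>C. \<forall>v\<in>C. comparable D u v"
    using comparable_sym[OF assms(1)] comparable_trans[OF assms(1)] by blast
next
  assume *: "\<forall>u\<in>C. \<forall>v\<in>C. comparable D u v"
  obtain u where u: "u \<in> C" using assms(3) by blast
  let ?R = "{(u, v). u \<in> D - {0} \<and> v \<in> D - {0} \<and> comparable D u v}"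
  have "?R `` {u} \<in> parts D" unfolding parts_def using u assms(2) by (intro quotientI) blast
  moreover have "C \<subseteq> ?R `` {u}" using * u assms(2) by blast
  ultimately show "\<exists>P\<in>parts D. C \<subseteq> P" by blast
qed

section \<open>The constants \<open>m_cone\<close> and \<open>M_cone\<close>\<close>

text \<open>Lowering an admissible factor adds a positive multiple of \<open>u\<close>, which lies
  in \<open>D\<close>, so admissible factors form a downward closed set. The inequality is strict
  because \<open>D\<close> is not assumed closed and the supremum need not be attained.\<close>

lemma cone_le_less_m_cone:
  assumes "is_cone D" "u \<in> D" "comparable D u v" "\<alpha> < m_cone D v u"
  shows "cone_le D (\<alpha> *\<^sub>R u) v"
proof -
  have "{\<alpha>. \<alpha> > 0 \<and> cone_le D (\<alpha> *\<^sub>R u) v} \<noteq> {}"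
    using assms(3) by (auto simp: comparable_def)
  then obtain a where a: "\<alpha> < a" "cone_le D (a *\<^sub>R u) v"
    using less_cSupD[OF _ assms(4)[unfolded m_cone_def]] by blast
  have "(a - \<alpha>) *\<^sub>R u \<in> D" using assms(1,2) a(1) by (simp add: is_cone_def)
  then have "cone_le D (\<alpha> *\<^sub>R u) (a *\<^sub>R u)" by (simp add: cone_le_def scaleR_diff_left)
  then show ?thesis using cone_le_trans[OF assms(1)] a(2) by blast
qed

lemma cone_le_greater_M_cone:
  assumes "is_cone D" "u \<in> D" "comparable D u v" "\<beta> > M_cone D v u"
  shows "cone_le D v (\<beta> *\<^sub>R u)"
proof -
  have "{\<beta>. \<beta> > 0 \<and> cone_le D v (\<beta> *\<^sub>R u)} \<noteq> {}"
    using assms(3) by (auto simp: comparable_def)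
  then obtain b where b: "b < \<beta>" "cone_le D v (b *\<^sub>R u)"
    using cInf_lessD[OF _ assms(4)[unfolded M_cone_def]] by blast
  have "(\<beta> - b) *\<^sub>R u \<in> D" using assms(1,2) b(1) by (simp add: is_cone_def)
  then have "cone_le D (b *\<^sub>R u) (\<beta> *\<^sub>R u)" by (simp add: cone_le_def scaleR_diff_left)
  then show ?thesis using cone_le_trans[OF assms(1)] b(2) by blast
qed

text \<open>The supremum dominates the positive factor given by comparability only because the set
  is bounded above; that bound rests on the salience of \<open>D\<close>.\<close>

lemma m_cone_pos:
  assumes "is_cone D" "u \<noteq> 0" "u \<in> D" "comparable D u v"
  shows "m_cone D v u > 0"
proof -
  obtain a where a: "a > 0" "cone_le D (a *\<^sub>R u) v"
    using assms(4) by (auto simp: comparable_def)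
  have "a \<le> m_cone D v u" unfolding m_cone_def
    using a comparable_bdd_above[OF assms] by (intro cSup_upper) auto
  then show ?thesis using a by simp
qed

section \<open>Ratios of equivalent norms\<close>

lemma equivalent_norms_pos:
  assumes "p \<in> equivalent_norms" "x \<noteq> 0"
  shows "p x > 0"
  using assms by (auto simp: equivalent_norms_def is_norm_def order_less_le)

lemma equivalent_norms_zero:
  assumes "p \<in> equivalent_norms"
  shows "p 0 = 0"
  using assms by (auto simp: equivalent_norms_def is_norm_def)

lemma equivalent_norms_lower:
  assumes "p \<in> equivalent_norms" "q \<in> equivalent_norms"
  obtains c where "c > 0" "\<And>x. c * p x \<le> q x"
proof -
  obtain a where a: "a > 0" "\<And>x. a * norm x \<le> q x"
    using assms(2) unfolding equivalent_norms_def by blast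
  obtain b where b: "b > 0" "\<And>x. p x \<le> b * norm x"
    using assms(1) unfolding equivalent_norms_def by blast
  have "(a / b) * p x \<le> q x" for x
  proof -
    have "(a / b) * p x \<le> (a / b) * (b * norm x)" using a b by (intro mult_left_mono) auto
    also have "\<dots> \<le> q x" using a b by simp
    finally show ?thesis .
  qed
  then show ?thesis using a(1) b(1) that[of "a / b"] by simp
qed

text \<open>The supremum runs over nonzero vectors only, but at 0 both sides vanish, so the bound
  holds on the whole space.\<close>

lemma le_M_log:
  assumes "p \<in> equivalent_norms" "q \<in> equivalent_norms"
  shows "q x \<le> M_log q p * p x"
proof (cases "x = 0")
  case False
  have "q x / p x \<le> M_log q p" unfolding M_log_def
    using False equivalent_norms_ratio_bdd(1)[OF assms] by (intro cSUP_upper) auto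
  then show ?thesis using equivalent_norms_pos[OF assms(1) False] by (simp add: divide_le_eq)
qed (simp add: assms equivalent_norms_zero)

lemma m_log_le:
  assumes "p \<in> equivalent_norms" "q \<in> equivalent_norms"
  shows "m_log q p * p x \<le> q x"
proof (cases "x = 0")
  case False
  have "m_log q p \<le> q x / p x" unfolding m_log_def
    using False equivalent_norms_ratio_bdd(2)[OF assms] by (intro cINF_lower) auto
  then show ?thesis using equivalent_norms_pos[OF assms(1) False] by (simp add: le_divide_eq)
qed (simp add: assms equivalent_norms_zero)

text \<open>The nonzero vector keeps the index set of the supremum nonempty, as a least upper bound
  argument in the reals requires.\<close>

lemma M_log_least:
  fixes p q :: "'a::real_normed_vector \<Rightarrow> real"
  assumes "\<exists>x::'a. x \<noteq> 0" "p \<in> equivalent_norms" "\<And>x. q x \<le> b * p x"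
  shows "M_log q p \<le> b"
  unfolding M_log_def using assms equivalent_norms_pos[OF assms(2)]
  by (intro cSUP_least) (auto simp: divide_le_eq)

lemma m_log_greatest:
  fixes p q :: "'a::real_normed_vector \<Rightarrow> real"
  assumes "\<exists>x::'a. x \<noteq> 0" "p \<in> equivalent_norms" "\<And>x. a * p x \<le> q x"
  shows "a \<le> m_log q p"
  unfolding m_log_def using assms equivalent_norms_pos[OF assms(2)]
  by (intro cINF_greatest) (auto simp: le_divide_eq)

lemma m_log_pos:
  fixes p q :: "'a::real_normed_vector \<Rightarrow> real"
  assumes "\<exists>x::'a. x \<noteq> 0" "p \<in> equivalent_norms" "q \<in> equivalent_norms"
  shows "m_log q p > 0"
  using equivalent_norms_lower[OF assms(2,3)] m_log_greatest[OF assms(1,2)]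
  by (metis less_le_trans)

text \<open>Evaluate both bounds for \<open>q\<close> at one nonzero vector and cancel the positive
  value of \<open>p\<close> there.\<close>

lemma m_log_le_M_log:
  fixes p q :: "'a::real_normed_vector \<Rightarrow> real"
  assumes "\<exists>x::'a. x \<noteq> 0" "p \<in> equivalent_norms" "q \<in> equivalent_norms"
  shows "m_log q p \<le> M_log q p"
  using le_M_log[OF assms(2,3)] m_log_le[OF assms(2,3)] equivalent_norms_pos[OF assms(2)] assms(1)
  by (meson mult_le_cancel_right_pos order_trans)

lemma M_log_pos:
  fixes p q :: "'a::real_normed_vector \<Rightarrow> real"
  assumes "\<exists>x::'a. x \<noteq> 0" "p \<in> equivalent_norms" "q \<in> equivalent_norms"
  shows "M_log q p > 0"
  using m_log_pos[OF assms] m_log_le_M_log[OF assms] by linarith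

section \<open>The cone constants against the pointwise ones\<close>

text \<open>The nonnegativity of the elements of \<open>D\<close> enters the whole argument only
  through this pointwise inequality.\<close>

lemma cone_le_nonneg_functions:
  assumes "D \<subseteq> nonneg_functions" "cone_le D f g"
  shows "f x \<le> g x"
  using assms by (force simp: cone_le_def nonneg_functions_def)

lemma M_log_le_M_cone:
  fixes p q :: "'a::real_normed_vector \<Rightarrow> real"
  assumes "\<exists>x::'a. x \<noteq> 0" "D \<subseteq> nonneg_functions" "p \<in> equivalent_norms" "comparable D p q"
  shows "M_log q p \<le> M_cone D q p"
  unfolding M_cone_def
proof (rule cInf_greatest)
  show "{\<beta>. \<beta> > 0 \<and> cone_le D q (\<beta> *\<^sub>R p)} \<noteq> {}"
    using assms(4) by (auto simp: comparable_def)
  show "M_log q p \<le> b" if "b \<in> {\<beta>. \<beta> > 0 \<and> cone_le D q (\<beta> *\<^sub>R p)}" for b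
    using that cone_le_nonneg_functions[OF assms(2), of q "b *\<^sub>R p"]
    by (intro M_log_least[OF assms(1,3)]) auto
qed

lemma m_cone_le_m_log:
  fixes p q :: "'a::real_normed_vector \<Rightarrow> real"
  assumes "\<exists>x::'a. x \<noteq> 0" "D \<subseteq> nonneg_functions" "p \<in> equivalent_norms" "comparable D p q"
  shows "m_cone D q p \<le> m_log q p"
  unfolding m_cone_def
proof (rule cSup_least)
  show "{\<alpha>. \<alpha> > 0 \<and> cone_le D (\<alpha> *\<^sub>R p) q} \<noteq> {}"
    using assms(4) by (auto simp: comparable_def)
  show "a \<le> m_log q p" if "a \<in> {\<alpha>. \<alpha> > 0 \<and> cone_le D (\<alpha> *\<^sub>R p) q}" for a
    using that cone_le_nonneg_functions[OF assms(2), of "a *\<^sub>R p" q]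
    by (intro m_log_greatest[OF assms(1,3)]) auto
qed

text \<open>Raising the numerator and lowering the denominator both increase a positive quotient, so
  an unchanged quotient forbids either change. After cross-multiplying, M' m' \<le> M m' = M' m
  gives m' \<le> m.\<close>

lemma divide_eq_squeeze:
  fixes m m' M M' :: real
  assumes "0 < m" "m \<le> m'" "0 < M'" "M' \<le> M" "M / m = M' / m'"
  shows "m = m'" "M = M'"
proof -
  have eq: "M * m' = M' * m" using assms by (simp add: field_simps)
  have "M' * m' \<le> M * m'" using assms by (intro mult_right_mono) auto
  then show "m = m'" using eq assms by simp
  then show "M = M'" using eq assms by simp
qed

section \<open>Equivalence of the four conditions\<close>

theorem theorem3p2:
  fixes C D :: "('a::banach \<Rightarrow> real) set"
  assumes "\<exists>x::'a. x \<noteq> 0"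
    and "subcone C equivalent_norms"
    and "D \<subseteq> nonneg_functions"
    and "cone_with_vertex D"
    and "C \<subseteq> D"
  shows "let
      S1 = (\<exists>P\<in>parts D. C \<subseteq> P) \<and>
        (\<forall>U\<in>ray ` C. \<forall>V\<in>ray ` C. hilbert_dist D U V = log_dist U V);
      S2 = \<forall>p\<in>C. \<forall>q\<in>C.
        (\<forall>\<beta>. \<beta> > M_log q p \<longrightarrow> \<beta> *\<^sub>R p - q \<in> D) \<and>
        (\<forall>\<alpha>. 0 < \<alpha> \<and> \<alpha> < m_log q p \<longrightarrow> q - \<alpha> *\<^sub>R p \<in> D);
      S3 = \<forall>p\<in>C. \<forall>q\<in>C. \<forall>\<theta>. 0 < \<theta> \<and> \<theta> < 1 \<and> (\<forall>x. q x \<le> \<theta> * p x) \<longrightarrow> p - q \<in> D;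
      S4 = {f \<in> cone_differences C. \<exists>r\<in>C. \<exists>\<epsilon>>0. \<forall>x. f x \<ge> \<epsilon> * r x} \<subseteq> D
    in (S1 \<longleftrightarrow> S2) \<and> (S2 \<longleftrightarrow> S3) \<and> (S3 \<longleftrightarrow> S4)"
proof -
  have coneD: "is_cone D" using assms(4) by (simp add: cone_with_vertex_def)
  have coneC: "is_cone C" and norms: "\<And>p. p \<in> C \<Longrightarrow> p \<in> equivalent_norms"
    using assms(2) by (auto simp: subcone_def)
  have scaleC: "c *\<^sub>R p \<in> C" if "c > 0" "p \<in> C" for c p
    using coneC that by (simp add: is_cone_def)
  have nz: "p \<in> D - {0}" if "p \<in> C" for p
    using equivalent_norms_pos[OF norms[OF that]] assms(1,5) that by force
  define S1 where "S1 \<longleftrightarrow> (\<exists>P\<in>parts D. C \<subseteq> P) \<and>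
        (\<forall>U\<in>ray ` C. \<forall>V\<in>ray ` C. hilbert_dist D U V = log_dist U V)"
  define S2 where "S2 \<longleftrightarrow> (\<forall>p\<in>C. \<forall>q\<in>C.
        (\<forall>\<beta>. \<beta> > M_log q p \<longrightarrow> \<beta> *\<^sub>R p - q \<in> D) \<and>
        (\<forall>\<alpha>. 0 < \<alpha> \<and> \<alpha> < m_log q p \<longrightarrow> q - \<alpha> *\<^sub>R p \<in> D))"
  define S3 where "S3 \<longleftrightarrow> (\<forall>p\<in>C. \<forall>q\<in>C. \<forall>\<theta>.
        0 < \<theta> \<and> \<theta> < 1 \<and> (\<forall>x. q x \<le> \<theta> * p x) \<longrightarrow> p - q \<in> D)"
  define S4 where "S4 \<longleftrightarrow>
        {f \<in> cone_differences C. \<exists>r\<in>C. \<exists>\<epsilon>>0. \<forall>x. f x \<ge> \<epsilon> * r x} \<subseteq> D"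

  have part: "(\<exists>P\<in>parts D. C \<subseteq> P) \<longleftrightarrow> (\<forall>p\<in>C. \<forall>q\<in>C. comparable D p q)"
    using coneC nz by (intro contained_in_part_iff[OF coneD]) (auto simp: is_cone_def)
  have dist: "hilbert_dist D (ray p) (ray q) = ln (M_cone D q p / m_cone D q p)"
      "log_dist (ray p) (ray q) = ln (M_log q p / m_log q p)"
    if "p \<in> C" "q \<in> C" "comparable D p q" for p q
    using hilbert_dist_ray[OF coneD nz[OF that(1)] that(3)]
      log_dist_ray[OF assms(1) norms[OF that(1)] norms[OF that(2)]] by auto

  have "S2" if "S1"
  proof -
    have "(\<forall>\<beta>. \<beta> > M_log q p \<longrightarrow> \<beta> *\<^sub>R p - q \<in> D) \<and>
        (\<forall>\<alpha>. 0 < \<alpha> \<and> \<alpha> < m_log q p \<longrightarrow> q - \<alpha> *\<^sub>R p \<in> D)" if pq: "p \<in> C" "q \<in> C" for p q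
    proof -
      have comp: "comparable D p q" using \<open>S1\<close> pq part by (simp add: S1_def)
      have pD: "p \<noteq> 0" "p \<in> D" using nz[OF pq(1)] by auto
      note m_pos = m_cone_pos[OF coneD pD comp]
      note m_le = m_cone_le_m_log[OF assms(1,3) norms[OF pq(1)] comp]
      note M_le = M_log_le_M_cone[OF assms(1,3) norms[OF pq(1)] comp]
      have M_pos: "0 < M_log q p"
        using M_log_pos assms(1) norms pq by blast
      have "ln (M_cone D q p / m_cone D q p) = ln (M_log q p / m_log q p)"
        using \<open>S1\<close> pq dist[OF pq comp] by (simp add: S1_def)
      \<comment> \<open>Positivity of both quotients is what allows the logarithms to be
        cancelled.\<close>
      moreover have "0 < M_cone D q p / m_cone D q p" "0 < M_log q p / m_log q p"
        using m_pos m_le M_le M_pos by (intro divide_pos_pos; linarith)+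
      ultimately have "M_cone D q p / m_cone D q p = M_log q p / m_log q p" by simp
      note eq = divide_eq_squeeze[OF m_pos m_le M_pos M_le this]
      show ?thesis
        using cone_le_greater_M_cone[OF coneD pD(2) comp] cone_le_less_m_cone[OF coneD pD(2) comp]
        by (auto simp: eq cone_le_def)
    qed
    then show ?thesis by (simp add: S2_def)
  qed
  moreover have "S1" if "S2"
  proof -
    have up: "cone_le D q (\<beta> *\<^sub>R p)" if "p \<in> C" "q \<in> C" "\<beta> > M_log q p" for p q \<beta>
      using \<open>S2\<close> that by (auto simp: S2_def cone_le_def)
    have low: "cone_le D (\<alpha> *\<^sub>R p) q" if "p \<in> C" "q \<in> C" "0 < \<alpha>" "\<alpha> < m_log q p" for p q \<alpha>
      using \<open>S2\<close> that by (auto simp: S2_def cone_le_def)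
    have pos: "0 < m_log q p" "0 < M_log q p" if "p \<in> C" "q \<in> C" for p q
      using m_log_pos[OF assms(1) norms norms] M_log_pos[OF assms(1) norms norms] that by auto
    \<comment> \<open>Condition 2) speaks only of strict inequalities, so the witnesses are moved
      off the extremal constants: one more than \<open>M_log\<close>, and half of
      \<open>m_log\<close>, which stays positive.\<close>
    have comp: "comparable D p q" if "p \<in> C" "q \<in> C" for p q
      unfolding comparable_def
      using pos[OF that] up[OF that, of "M_log q p + 1"] low[OF that, of "m_log q p / 2"]
      by (intro exI[of _ "m_log q p / 2"] conjI exI[of _ "M_log q p + 1"]) auto
    have "M_cone D q p = M_log q p" if pq: "p \<in> C" "q \<in> C" for p q
    proof (rule antisym)
      \<comment> \<open>Every factor strictly above \<open>M_log\<close> is admissible, while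
        \<open>M_log\<close> itself may not be; hence the approach from above by density.\<close>
      show "M_cone D q p \<le> M_log q p"
      proof (rule dense_ge)
        fix b assume "b > M_log q p"
        then show "M_cone D q p \<le> b" unfolding M_cone_def using up[OF pq] pos[OF pq]
          by (intro cInf_lower) (auto intro: bdd_belowI[of _ 0])
      qed
    qed (use M_log_le_M_cone[OF assms(1,3) norms comp] pq in auto)
    moreover have "m_cone D q p = m_log q p" if pq: "p \<in> C" "q \<in> C" for p q
    proof (rule antisym)
      \<comment> \<open>The bounded form of the density argument tests only positive factors, the
        ones over which \<open>m_cone\<close> takes its supremum.\<close>
      show "m_log q p \<le> m_cone D q p"
      proof (rule dense_le_bounded[OF pos(1)[OF pq]])
        fix a assume "0 < a" "a < m_log q p"
        then show "a \<le> m_cone D q p" unfolding m_cone_def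
          using low[OF pq] comparable_bdd_above[OF coneD _ _ comp[OF pq]] nz[OF pq(1)]
          by (intro cSup_upper) auto
      qed
    qed (use m_cone_le_m_log[OF assms(1,3) norms comp] pq in auto)
    ultimately show ?thesis using comp part by (auto simp: S1_def dist)
  qed
  moreover have "S3" if "S2"
  proof -
    have "p - q \<in> D" if "p \<in> C" "q \<in> C" "\<theta> < 1" "\<And>x. q x \<le> \<theta> * p x" for p q \<theta>
    proof -
      have "M_log q p < 1"
        using M_log_least[OF assms(1) norms[OF that(1)] that(4)] that(3) by linarith
      \<comment> \<open>Here \<open>M_log q p\<close> is at most \<theta> < 1, so the factor 1 is
        admissible in 2).\<close>
      then have "1 *\<^sub>R p - q \<in> D" using \<open>S2\<close> that(1,2) unfolding S2_def by blast
      then show ?thesis by simp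
    qed
    then show ?thesis unfolding S3_def by blast
  qed
  moreover have "S2" if "S3"
  proof -
    have S3: "p - q \<in> D" if "p \<in> C" "q \<in> C" "0 < \<theta>" "\<theta> < 1" "\<And>x. q x \<le> \<theta> * p x" for p q \<theta>
      using \<open>S3\<close> that unfolding S3_def by blast
    have "\<beta> *\<^sub>R p - q \<in> D" if pq: "p \<in> C" "q \<in> C" and "\<beta> > M_log q p" for p q \<beta>
    proof -
      have M: "0 < M_log q p"
        using M_log_pos assms(1) norms pq by blast
      \<comment> \<open>Apply 3) to the rescaled norm \<beta> p and to q: the bound q \<le> M p,
        with M = \<open>M_log q p\<close>, reads q \<le> (M/\<beta>) (\<beta> p), and M/\<beta> <
        1.\<close>
      show ?thesis
        by (rule S3[OF scaleC pq(2), of _ _ "M_log q p / \<beta>"])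
          (use M that le_M_log[OF norms norms] in auto)
    qed
    moreover have "q - \<alpha> *\<^sub>R p \<in> D"
      if pq: "p \<in> C" "q \<in> C" and a: "0 < \<alpha>" "\<alpha> < m_log q p" for p q \<alpha>
    \<comment> \<open>Now q is the larger norm and \<alpha> p the smaller one; multiplying m p \<le>
      q, with m = \<open>m_log q p\<close>, by \<alpha>/m < 1 gives the hypothesis of 3).\<close>
    proof (rule S3[OF pq(2) scaleC[OF a(1) pq(1)], of "\<alpha> / m_log q p"])
      have "(\<alpha> / m_log q p) * (m_log q p * p x) \<le> (\<alpha> / m_log q p) * q x" for x
        using a m_log_le[OF norms norms, OF pq] by (intro mult_left_mono) auto
      then show "(\<alpha> *\<^sub>R p) x \<le> \<alpha> / m_log q p * q x" for x using a by simp
    qed (use a in auto)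
    ultimately show ?thesis by (simp add: S2_def)
  qed
  moreover have "S4" if "S3"
  proof -
    have "p - q \<in> D" if pq: "p \<in> C" "q \<in> C" and r: "r \<in> C" "\<epsilon> > 0" "\<And>x. (p - q) x \<ge> \<epsilon> * r x"
      for p q r \<epsilon>
    proof -
      \<comment> \<open>The gap in 4) is measured by r, that in 3) by p; equivalence of the two
        norms converts one into the other.\<close>
      obtain c where c: "c > 0" "\<And>x. c * p x \<le> r x"
        using equivalent_norms_lower[OF norms[OF pq(1)] norms[OF r(1)]] by blast
      \<comment> \<open>The gap p - q is at least \<epsilon> c p, which suggests \<theta> = 1 -
        \<epsilon> c; capping the subtracted number at 1/2 keeps \<theta> visibly positive.\<close>
      define \<delta> where "\<delta> = min (1/2) (\<epsilon> * c)"
      have "q x \<le> (1 - \<delta>) * p x" for x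
      proof -
        have "p x \<ge> 0" using norms[OF pq(1)] by (auto simp: equivalent_norms_def is_norm_def)
        then have "\<delta> * p x \<le> \<epsilon> * c * p x" by (intro mult_right_mono) (simp add: \<delta>_def)
        also have "\<dots> \<le> \<epsilon> * r x" using c r(2) by (simp add: mult.assoc)
        also have "\<dots> \<le> p x - q x" using r(3) by simp
        finally show ?thesis by (simp add: algebra_simps)
      qed
      moreover have "0 < 1 - \<delta>" "1 - \<delta> < 1" using c r(2) by (auto simp: \<delta>_def)
      ultimately show ?thesis using \<open>S3\<close> pq unfolding S3_def by blast
    qed
    then show ?thesis unfolding S4_def cone_differences_def by blast
  qed
  moreover have "S3" if "S4"
  proof -
    have "p - q \<in> D" if "p \<in> C" "q \<in> C" "\<theta> < 1" "\<And>x. q x \<le> \<theta> * p x" for p q \<theta>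
    proof -
      \<comment> \<open>The norm p itself serves as r, with \<epsilon> = 1 - \<theta>.\<close>
      have "(p - q) x \<ge> (1 - \<theta>) * p x" for x using that(4)[of x] by (simp add: algebra_simps)
      moreover have "1 - \<theta> > 0" using that(3) by simp
      ultimately show ?thesis
        using \<open>S4\<close> that(1,2) unfolding S4_def cone_differences_def by blast
    qed
    then show ?thesis unfolding S3_def by blast
  qed
  ultimately have "(S1 \<longleftrightarrow> S2) \<and> (S2 \<longleftrightarrow> S3) \<and> (S3 \<longleftrightarrow> S4)" by blast
  then show ?thesis unfolding Let_def S1_def S2_def S3_def S4_def .
qed

end
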